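(* Let $\mathbb{K}$ be an algebraically closed field, let $q\in\mathbb{K}^*$ be such that $q^2$ is a primitive $l$-th root of unity with $l>1$, and let $\alpha,\beta,\gamma\in\mathbb{K}$. Then the center of the 3-cyclic quantum Weyl algebra $A(\alpha,\beta,\gamma)$ is generated (as a $\mathbb{K}$-algebra) by $x^l$, $y^l$, $z^l$ and $$\Omega=yxz+\frac{q^{-2}\gamma}{q^2-1}x-\frac{q^2\beta}{q^2-1}y+\frac{\alpha}{q^2-1}z.$$
   Context: For $\alpha,\beta,\gamma\in\mathbb{K}$ and $q\in\mathbb{K}^*$, the 3-cyclic quantum Weyl algebra $A(\alpha,\beta,\gamma)$ is the associative unital $\mathbb{K}$-algebra generated by $x,y,z$ subject to the relations $xy=q^2yx+\alpha$, $xz=q^{-2}zx+\beta$, $yz=q^2zy+\gamma$. *)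

theory Defs
  imports
    "HOL-Library.Poly_Mapping"
    "HOL-Algebra.Algebra"
    "HOL-Algebra.Algebraic_Closure_Type"
begin

definition primitive_root_of_unity :: "nat \<Rightarrow> 'k :: field \<Rightarrow> bool" where
  "primitive_root_of_unity n w \<longleftrightarrow> n > 0 \<and> w ^ n = 1 \<and> (\<forall>m. 0 < m \<and> m < n \<longrightarrow> w ^ m \<noteq> 1)"

definition ring_center :: "('a, 'b) ring_scheme \<Rightarrow> 'a set" where
  "ring_center R = {c \<in> carrier R. \<forall>a \<in> carrier R. c \<otimes>\<^bsub>R\<^esub> a = a \<otimes>\<^bsub>R\<^esub> c}"

text \<open>Words under concatenation, written additively so that the convolution product of
  \<^theory>\<open>HOL-Library.Poly_Mapping\<close> turns finitely supported functions on words into the free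
  associative algebra.\<close>

datatype 'g free_word = Word (letters: "'g list")

instantiation free_word :: (type) monoid_add
begin

definition zero_free_word :: "'g free_word" where
  "zero_free_word = Word []"

definition plus_free_word :: "'g free_word \<Rightarrow> 'g free_word \<Rightarrow> 'g free_word" where
  "plus_free_word u v = Word (letters u @ letters v)"

instance
  by standard (auto simp: zero_free_word_def plus_free_word_def)

end

datatype gen3 = GX | GY | GZ

type_synonym 'k free3 = "gen3 free_word \<Rightarrow>\<^sub>0 'k"

definition scal :: "'k :: field \<Rightarrow> 'k free3" where
  "scal c = Poly_Mapping.single 0 c"

definition gen :: "gen3 \<Rightarrow> 'k :: field free3" where
  "gen g = Poly_Mapping.single (Word [g]) 1"

abbreviation free3_ring :: "'k :: field free3 ring" where
  "free3_ring \<equiv> ring_of_type_algebra"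

definition weyl_relators :: "'k :: field \<Rightarrow> 'k \<Rightarrow> 'k \<Rightarrow> 'k \<Rightarrow> 'k free3 set" where
  "weyl_relators q \<alpha> \<beta> \<gamma> =
    {gen GX * gen GY - (scal (q^2) * gen GY * gen GX + scal \<alpha>),
     gen GX * gen GZ - (scal (inverse (q^2)) * gen GZ * gen GX + scal \<beta>),
     gen GY * gen GZ - (scal (q^2) * gen GZ * gen GY + scal \<gamma>)}"

text \<open>\<^const>\<open>genideal\<close> is the two-sided ideal generated by a set, also over noncommutative rings.\<close>

definition weyl_ideal :: "'k :: field \<Rightarrow> 'k \<Rightarrow> 'k \<Rightarrow> 'k \<Rightarrow> 'k free3 set" where
  "weyl_ideal q \<alpha> \<beta> \<gamma> = Idl\<^bsub>free3_ring\<^esub> (weyl_relators q \<alpha> \<beta> \<gamma>)"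

definition weyl_algebra :: "'k :: field \<Rightarrow> 'k \<Rightarrow> 'k \<Rightarrow> 'k \<Rightarrow> 'k free3 set ring" where
  "weyl_algebra q \<alpha> \<beta> \<gamma> = free3_ring Quot weyl_ideal q \<alpha> \<beta> \<gamma>"

definition weyl_class :: "'k :: field \<Rightarrow> 'k \<Rightarrow> 'k \<Rightarrow> 'k \<Rightarrow> 'k free3 \<Rightarrow> 'k free3 set" where
  "weyl_class q \<alpha> \<beta> \<gamma> f = weyl_ideal q \<alpha> \<beta> \<gamma> +>\<^bsub>free3_ring\<^esub> f"

definition weyl_scal :: "'k :: field \<Rightarrow> 'k \<Rightarrow> 'k \<Rightarrow> 'k \<Rightarrow> 'k \<Rightarrow> 'k free3 set" where
  "weyl_scal q \<alpha> \<beta> \<gamma> c = weyl_class q \<alpha> \<beta> \<gamma> (scal c)"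

definition weyl_gen :: "'k :: field \<Rightarrow> 'k \<Rightarrow> 'k \<Rightarrow> 'k \<Rightarrow> gen3 \<Rightarrow> 'k free3 set" where
  "weyl_gen q \<alpha> \<beta> \<gamma> g = weyl_class q \<alpha> \<beta> \<gamma> (gen g)"

text \<open>A unital \<open>\<K>\<close>-subalgebra is a subring containing the image of \<open>\<K>\<close>.\<close>

definition weyl_subalgebra_generated ::
    "'k :: field \<Rightarrow> 'k \<Rightarrow> 'k \<Rightarrow> 'k \<Rightarrow> 'k free3 set set \<Rightarrow> 'k free3 set set" where
  "weyl_subalgebra_generated q \<alpha> \<beta> \<gamma> S =
    generate_ring (weyl_algebra q \<alpha> \<beta> \<gamma>) (range (weyl_scal q \<alpha> \<beta> \<gamma>) \<union> S)"

definition weyl_Omega :: "'k :: field \<Rightarrow> 'k \<Rightarrow> 'k \<Rightarrow> 'k \<Rightarrow> 'k free3 set" where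
  "weyl_Omega q \<alpha> \<beta> \<gamma> =
    (let A = weyl_algebra q \<alpha> \<beta> \<gamma>;
         x = weyl_gen q \<alpha> \<beta> \<gamma> GX; y = weyl_gen q \<alpha> \<beta> \<gamma> GY; z = weyl_gen q \<alpha> \<beta> \<gamma> GZ;
         k = weyl_scal q \<alpha> \<beta> \<gamma>
     in y \<otimes>\<^bsub>A\<^esub> x \<otimes>\<^bsub>A\<^esub> z
        \<oplus>\<^bsub>A\<^esub> k (inverse (q^2) * \<gamma> / (q^2 - 1)) \<otimes>\<^bsub>A\<^esub> x
        \<ominus>\<^bsub>A\<^esub> k (q^2 * \<beta> / (q^2 - 1)) \<otimes>\<^bsub>A\<^esub> y
        \<oplus>\<^bsub>A\<^esub> k (\<alpha> / (q^2 - 1)) \<otimes>\<^bsub>A\<^esub> z)"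

lemma ring_free3_ring: "ring (free3_ring :: 'k :: field free3 ring)"
proof -
  have "\<exists>y. x + y = 0" for x :: "'k free3"
    using add.right_inverse by blast
  thus ?thesis
    unfolding ring_of_type_algebra_def
    by unfold_locales (auto simp: algebra_simps Units_def intro: add.left_inverse)
qed

lemma ideal_weyl_ideal: "ideal (weyl_ideal q \<alpha> \<beta> \<gamma>) free3_ring"
  unfolding weyl_ideal_def
  by (rule ring.genideal_ideal[OF ring_free3_ring]) (simp add: ring_of_type_algebra_def)

lemma ring_weyl_algebra: "ring (weyl_algebra q \<alpha> \<beta> \<gamma>)"
  unfolding weyl_algebra_def by (rule ideal.quotient_is_ring[OF ideal_weyl_ideal])

end

theory Submission
  imports Defs "HOL-Library.Product_Plus"
begin

text \<open>Write \<open>p = q\<^sup>2\<close>. The formulas for left multiplication by the generators on the ordered monomials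
  \<open>y\<^sup>a x\<^sup>b z\<^sup>c\<close> define operators on the free vector space on triples \<open>(a, b, c)\<close>. These operators satisfy
  the defining relations, so the space is a module over the algebra, and applying an element to the
  basis vector \<open>(0, 0, 0)\<close> recovers its coefficients in the ordered monomials.

  Up to terms of lower total degree the generators commute up to powers of \<open>p\<close>. Comparing the
  top-degree parts of \<open>x f - f x\<close> and \<open>y f - f y\<close> shows that every top-degree monomial of a central
  element \<open>f\<close> satisfies \<open>p\<^sup>a = p\<^sup>b = p\<^sup>c\<close>, that is, the three exponents agree modulo \<open>l\<close>. With
  \<open>m = min(a, b, c)\<close> such a monomial is, up to a nonzero scalar, the leading term of \<open>\<Omega>\<^sup>m\<close> times a
  product of powers of \<open>y\<^sup>l\<close>, \<open>x\<^sup>l\<close>, \<open>z\<^sup>l\<close>. Subtracting these products lowers the degree of \<open>f\<close>.\<close>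

abbreviation "single \<equiv> Poly_Mapping.single"
abbreviation "lookup \<equiv> Poly_Mapping.lookup"
abbreviation "keys \<equiv> Poly_Mapping.keys"

subsection \<open>Linear maps between spaces of finitely supported functions\<close>

lemma single_0_commute:
  fixes f :: "'a::monoid_add \<Rightarrow>\<^sub>0 'k::comm_semiring_1"
  shows "f * single 0 c = single 0 c * f"
proof (induction f rule: update_induct)
  case const
  then show ?case by simp
next
  case (update f a b)
  have "Poly_Mapping.update a b f = f + single a b"
    using update(1) by (intro poly_mapping_eqI)
      (auto simp: lookup_update lookup_add lookup_single in_keys_iff when_def)
  then show ?case
    using update by (simp add: distrib_left distrib_right mult_single mult.commute)
qed

lemma lookup_single_0_mult:
  fixes f :: "'a::monoid_add \<Rightarrow>\<^sub>0 'k::comm_semiring_1"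
  shows "lookup (single 0 c * f) k = c * lookup f k"
  by (subst mult_map_scale_conv_mult [symmetric]) (simp add: Poly_Mapping.map.rep_eq when_def)

text \<open>Scalar multiplication is convolution with \<open>single 0 c\<close>, so one notion of
  linearity fits both the free algebra and the space on triples. On triples convolution serves for
  scalars alone; it is not the product of the Weyl algebra.\<close>

definition lin :: "(('a::monoid_add \<Rightarrow>\<^sub>0 'k::field) \<Rightarrow> ('b::monoid_add \<Rightarrow>\<^sub>0 'k)) \<Rightarrow> bool" where
  "lin L \<longleftrightarrow> (\<forall>f g. L (f + g) = L f + L g) \<and>
     (\<forall>c f. L (single 0 c * f) = single 0 c * L f)"

lemma linI:
  assumes "\<And>f g. L (f + g) = L f + L g"
    and "\<And>c f. L (single 0 c * f) = single 0 c * L f"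
  shows "lin L"
  using assms by (auto simp: lin_def)

lemma lin_add: "lin L \<Longrightarrow> L (f + g) = L f + L g"
  by (simp add: lin_def)

lemma lin_scale: "lin L \<Longrightarrow> L (single 0 c * f) = single 0 c * L f"
  by (simp add: lin_def)

lemma lin_0: "lin L \<Longrightarrow> L 0 = 0"
  using lin_scale [of L 0 0] by simp

lemma lin_uminus: "lin L \<Longrightarrow> L (- f) = - L f"
  using lin_add [of L f "- f"] by (simp add: lin_0 eq_neg_iff_add_eq_0 add.commute)

lemma lin_diff: "lin L \<Longrightarrow> L (f - g) = L f - L g"
  using lin_add [of L f "- g"] by (simp add: lin_uminus)

lemma lin_sum: "lin L \<Longrightarrow> L (sum f A) = (\<Sum>a\<in>A. L (f a))"
  by (induction A rule: infinite_finite_induct) (simp_all add: lin_0 lin_add)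

lemma lin_single: "lin L \<Longrightarrow> L (single k c) = single 0 c * L (single k 1)"
  using lin_scale [of L c "single k 1"] by (simp add: mult_single)

lemma lin_eqI:
  assumes "lin L" "lin M" "\<And>k. L (single k 1) = M (single k 1)"
  shows "L f = M f"
proof (induction f rule: update_induct)
  case const
  then show ?case by (simp add: assms lin_0)
next
  case (update f a b)
  have "Poly_Mapping.update a b f = f + single a b"
    using update(1) by (intro poly_mapping_eqI)
      (auto simp: lookup_update lookup_add lookup_single in_keys_iff when_def)
  then show ?case
    using update assms by (simp add: lin_add lin_single [of _ a b])
qed

lemma lin_compose: "lin L \<Longrightarrow> lin M \<Longrightarrow> lin (\<lambda>f. L (M f))"
  by (simp add: lin_def)

lemma lin_ident: "lin (\<lambda>f. f)"
  by (simp add: lin_def)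

lemma lin_minus: "lin L \<Longrightarrow> lin M \<Longrightarrow> lin (\<lambda>f. L f - M f)"
  by (simp add: lin_def algebra_simps)

lemma lin_mult_left: "lin ((*) a)"
  unfolding lin_def by (metis distrib_left mult.assoc single_0_commute)

lemma lin_mult_right: "lin (\<lambda>f. f * a)"
  by (simp add: lin_def distrib_right mult.assoc)

definition lin_ext :: "('a::monoid_add \<Rightarrow> ('b::monoid_add \<Rightarrow>\<^sub>0 'k::field)) \<Rightarrow> ('a \<Rightarrow>\<^sub>0 'k) \<Rightarrow> ('b \<Rightarrow>\<^sub>0 'k)" where
  "lin_ext h f = (\<Sum>a\<in>keys f. single 0 (lookup f a) * h a)"

lemma lin_ext_superset:
  "finite A \<Longrightarrow> keys f \<subseteq> A \<Longrightarrow> lin_ext h f = (\<Sum>a\<in>A. single 0 (lookup f a) * h a)"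
  unfolding lin_ext_def by (rule sum.mono_neutral_left) (auto simp: in_keys_iff)

lemma lin_lin_ext: "lin (lin_ext h)"
proof (rule linI)
  fix f g :: "'a \<Rightarrow>\<^sub>0 'b"
  let ?A = "keys f \<union> keys g"
  show "lin_ext h (f + g) = lin_ext h f + lin_ext h g"
    using keys_add [of f g]
    by (simp add: lin_ext_superset [of ?A] lookup_add single_add distrib_right sum.distrib)
next
  fix c and f :: "'a \<Rightarrow>\<^sub>0 'b"
  have "keys (single 0 c * f) \<subseteq> keys f"
    by (auto simp: in_keys_iff lookup_single_0_mult)
  then show "lin_ext h (single 0 c * f) = single 0 c * lin_ext h f"
    by (simp add: lin_ext_superset [of "keys f"] lookup_single_0_mult sum_distrib_left
        mult.assoc [symmetric] mult_single)
qed

lemma lin_ext_single: "lin_ext h (single k c) = single 0 c * h k"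
  by (simp add: lin_ext_superset [of "{k}"])

lemma lin_conv_lin_ext: "lin L \<Longrightarrow> L f = lin_ext (\<lambda>k. L (single k 1)) f"
  by (rule lin_eqI) (simp_all add: lin_lin_ext lin_ext_single)

lemma lookup_lin_ext: "lookup (lin_ext h f) k = (\<Sum>a\<in>keys f. lookup f a * lookup (h a) k)"
  by (simp add: lin_ext_def lookup_sum lookup_single_0_mult)

subsection \<open>Congruence modulo the defining ideal\<close>

lemma carrier_free3_ring [simp]: "carrier free3_ring = UNIV"
  and zero_free3_ring [simp]: "\<zero>\<^bsub>free3_ring\<^esub> = 0"
  and one_free3_ring [simp]: "\<one>\<^bsub>free3_ring\<^esub> = 1"
  and add_free3_ring [simp]: "a \<oplus>\<^bsub>free3_ring\<^esub> b = a + b"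
  and mult_free3_ring [simp]: "a \<otimes>\<^bsub>free3_ring\<^esub> b = a * b"
  by (simp_all add: ring_of_type_algebra_def)

lemma uminus_free3_ring [simp]: "\<ominus>\<^bsub>free3_ring\<^esub> (a :: 'k::field free3) = - a"
proof -
  interpret ring "free3_ring :: 'k free3 ring" by (rule ring_free3_ring)
  show ?thesis using minus_equality [of "- a" a] by simp
qed

lemma scal_commute: "f * scal c = scal c * f"
  by (simp add: scal_def single_0_commute)

lemma scal_left_commute: "f * (scal c * g) = scal c * (f * g)"
  by (metis mult.assoc scal_commute)

lemma scal_add: "scal (c + d) = scal c + scal d"
  by (simp add: scal_def single_add)

lemma scal_uminus: "scal (- c) = - scal c"
  by (simp add: scal_def single_uminus)

lemma scal_mult: "scal (c * d) = scal c * scal d"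
  by (simp add: scal_def mult_single)

lemma scal_0 [simp]: "scal 0 = 0" and scal_1 [simp]: "scal 1 = 1"
  by (simp_all add: scal_def)

locale weyl =
  fixes q \<alpha> \<beta> \<gamma> :: "'k::field"
  assumes q_nonzero: "q \<noteq> 0"
begin

abbreviation "I \<equiv> weyl_ideal q \<alpha> \<beta> \<gamma>"

text \<open>Computations are made with representatives in the free algebra; \<open>cl_eq_iff\<close>
  later translates them to cosets.\<close>

definition congr :: "'k free3 \<Rightarrow> 'k free3 \<Rightarrow> bool" (infix "\<doteq>" 50) where
  "f \<doteq> g \<longleftrightarrow> f - g \<in> I"

lemma zero_mem: "0 \<in> I"
  and add_mem: "a \<in> I \<Longrightarrow> b \<in> I \<Longrightarrow> a + b \<in> I"
  and mult_left_mem: "a \<in> I \<Longrightarrow> f * a \<in> I"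
  and mult_right_mem: "a \<in> I \<Longrightarrow> a * f \<in> I"
proof -
  interpret J: ideal I free3_ring by (rule ideal_weyl_ideal)
  show "0 \<in> I" using additive_subgroup.zero_closed [OF J.additive_subgroup_axioms] by simp
  show "a \<in> I \<Longrightarrow> b \<in> I \<Longrightarrow> a + b \<in> I" using additive_subgroup.a_closed [OF J.additive_subgroup_axioms] by fastforce
  show "a \<in> I \<Longrightarrow> f * a \<in> I" using J.I_l_closed [of a f] by simp
  show "a \<in> I \<Longrightarrow> a * f \<in> I" using J.I_r_closed [of a f] by simp
qed

lemma uminus_mem: "a \<in> I \<Longrightarrow> - a \<in> I"
  using mult_left_mem [of a "- 1"] by simp

lemma cong_refl [simp]: "f \<doteq> f"
  by (simp add: congr_def zero_mem)

lemma cong_sym: "f \<doteq> g \<Longrightarrow> g \<doteq> f"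
  unfolding congr_def using uminus_mem [of "f - g"] by simp

lemma cong_trans [trans]: "f \<doteq> g \<Longrightarrow> g \<doteq> h \<Longrightarrow> f \<doteq> h"
  unfolding congr_def using add_mem [of "f - g" "g - h"] by simp

lemma cong_add: "f \<doteq> f' \<Longrightarrow> g \<doteq> g' \<Longrightarrow> f + g \<doteq> f' + g'"
  unfolding congr_def using add_mem [of "f - f'" "g - g'"] by (simp add: algebra_simps)

lemma cong_uminus: "f \<doteq> f' \<Longrightarrow> - f \<doteq> - f'"
  unfolding congr_def using uminus_mem [of "f - f'"] by simp

lemma cong_mult: "f \<doteq> f' \<Longrightarrow> g \<doteq> g' \<Longrightarrow> f * g \<doteq> f' * g'"
proof -
  assume "f \<doteq> f'" "g \<doteq> g'"
  then have "(f - f') * g + f' * (g - g') \<in> I"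
    unfolding congr_def by (intro add_mem mult_left_mem mult_right_mem)
  then show ?thesis by (simp add: congr_def algebra_simps)
qed

abbreviation "gx \<equiv> gen GX :: 'k free3"
abbreviation "gy \<equiv> gen GY :: 'k free3"
abbreviation "gz \<equiv> gen GZ :: 'k free3"

definition "p = q\<^sup>2"
definition "r = inverse p"

lemma p_r [simp]: "p * r = 1" "r * p = 1" and p_nonzero [simp]: "p \<noteq> 0"
  using q_nonzero by (simp_all add: p_def r_def)

lemma relators_cong:
  shows XY: "gx * gy \<doteq> scal p * (gy * gx) + scal \<alpha>"
    and XZ: "gx * gz \<doteq> scal r * (gz * gx) + scal \<beta>"
    and YZ: "gy * gz \<doteq> scal p * (gz * gy) + scal \<gamma>"
proof -
  have "weyl_relators q \<alpha> \<beta> \<gamma> \<subseteq> I"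
    unfolding weyl_ideal_def
    by (rule ring.genideal_self [OF ring_free3_ring]) simp
  then show "gx * gy \<doteq> scal p * (gy * gx) + scal \<alpha>"
    and "gx * gz \<doteq> scal r * (gz * gx) + scal \<beta>"
    and "gy * gz \<doteq> scal p * (gz * gy) + scal \<gamma>"
    by (simp_all add: weyl_relators_def congr_def p_def r_def mult.assoc)
qed

text \<open>Multiplying by the inverse \<open>e\<close> of \<open>c\<close> solves the relation for
  the opposite product, so each pair of generators can be exchanged in either direction.\<close>

lemma cong_swap:
  assumes "a * b \<doteq> scal c * (b * a) + scal d" and "e * c = 1"
  shows "b * a \<doteq> scal e * (a * b) + scal (- (e * d))"
proof -
  have "scal e * (a * b) + scal (- (e * d)) \<doteq>
      scal e * (scal c * (b * a) + scal d) + scal (- (e * d))"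
    by (intro cong_add cong_mult assms cong_refl)
  also have "\<dots> = scal (e * c) * (b * a)"
    by (simp add: scal_mult scal_uminus distrib_left mult.assoc)
  also have "\<dots> = b * a" using assms(2) by simp
  finally show ?thesis by (rule cong_sym)
qed

lemma YX: "gy * gx \<doteq> scal r * (gx * gy) + scal (- (r * \<alpha>))"
  and ZX: "gz * gx \<doteq> scal p * (gx * gz) + scal (- (p * \<beta>))"
  and ZY: "gz * gy \<doteq> scal r * (gy * gz) + scal (- (r * \<gamma>))"
  by (rule cong_swap [OF XY p_r(2)] cong_swap [OF XZ p_r(1)] cong_swap [OF YZ p_r(2)])+

section \<open>Moving a generator past a power of another\<close>

definition geo :: "'k \<Rightarrow> nat \<Rightarrow> 'k" where
  "geo t n = (\<Sum>i<n. t ^ i)"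

lemma geo_0 [simp]: "geo t 0 = 0"
  by (simp add: geo_def)

lemma geo_Suc: "geo t (Suc n) = 1 + t * geo t n"
  by (simp add: geo_def sum.lessThan_Suc_shift sum_distrib_left del: sum.lessThan_Suc)

text \<open>Each of the \<open>n\<close> exchanges leaves \<open>d\<close> times a power of
  \<open>c\<close>, and these add up to the quantum integer \<open>geo c n\<close>. For
  \<open>n = 0\<close> the truncated exponent \<open>n - 1\<close> is harmless because
  \<open>geo c 0 = 0\<close>.\<close>

lemma cong_power_right:
  assumes "a * b \<doteq> scal c * (b * a) + scal d"
  shows "a * b ^ n \<doteq> scal (c ^ n) * (b ^ n * a) + scal (d * geo c n) * b ^ (n - 1)"
proof (induction n)
  case 0
  then show ?case by simp
next
  case (Suc n)
  have *: "scal (d * geo c n) * (b * b ^ (n - 1)) = scal (d * geo c n) * b ^ n"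
    by (cases n) simp_all
  have **: "scal (d * geo c (Suc n)) = scal c * scal (d * geo c n) + scal d"
    by (simp add: geo_Suc scal_add [symmetric] scal_mult [symmetric] algebra_simps)
  have "a * b ^ Suc n = (a * b) * b ^ n"
    by (simp add: mult.assoc)
  also have "\<dots> \<doteq> (scal c * (b * a) + scal d) * b ^ n"
    by (intro cong_mult assms cong_refl)
  also have "\<dots> = scal c * (b * (a * b ^ n)) + scal d * b ^ n"
    by (simp add: algebra_simps)
  also have "\<dots> \<doteq> scal c * (b * (scal (c ^ n) * (b ^ n * a) + scal (d * geo c n) * b ^ (n - 1))) + scal d * b ^ n"
    by (intro cong_add cong_mult Suc cong_refl)
  also have "\<dots> = scal (c ^ Suc n) * (b ^ Suc n * a) + (scal c * (scal (d * geo c n) * (b * b ^ (n - 1))) + scal d * b ^ n)"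
    by (simp add: distrib_left scal_left_commute [of b] scal_mult mult.assoc add.assoc)
  also have "\<dots> = scal (c ^ Suc n) * (b ^ Suc n * a) + scal (d * geo c (Suc n)) * b ^ (Suc n - 1)"
    unfolding * ** by (simp add: distrib_right mult.assoc)
  finally show ?case .
qed

subsection \<open>The faithful module with basis $y^a x^b z^c$\<close>

text \<open>The coefficients arise from moving a generator to its place in \<open>y\<^sup>a x\<^sup>b z\<^sup>c\<close>. Where \<open>a - 1\<close> or
  \<open>b - 1\<close> is truncated, the factor \<open>geo _ 0 = 0\<close> removes the term.\<close>

fun basis_op :: "gen3 \<Rightarrow> nat \<times> nat \<times> nat \<Rightarrow> (nat \<times> nat \<times> nat) \<Rightarrow>\<^sub>0 'k" where
  "basis_op GY (a, b, c) = single (Suc a, b, c) 1"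
| "basis_op GX (a, b, c) = single (a, Suc b, c) (p ^ a)
     + single (a - 1, b, c) (\<alpha> * geo p a)"
| "basis_op GZ (a, b, c) = single (a, b, Suc c) (r ^ a * p ^ b)
     + single (a, b - 1, c) (r ^ a * (- (p * \<beta>) * geo p b))
     + single (a - 1, b, c) (- (r * \<gamma>) * geo r a)"

definition gen_op :: "gen3 \<Rightarrow> (nat \<times> nat \<times> nat \<Rightarrow>\<^sub>0 'k) \<Rightarrow> (nat \<times> nat \<times> nat \<Rightarrow>\<^sub>0 'k)" where
  "gen_op g = lin_ext (basis_op g)"

definition act :: "'k free3 \<Rightarrow> (nat \<times> nat \<times> nat \<Rightarrow>\<^sub>0 'k) \<Rightarrow> (nat \<times> nat \<times> nat \<Rightarrow>\<^sub>0 'k)" where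
  "act f v = lin_ext (\<lambda>w. foldr gen_op (letters w) v) f"

lemma lin_gen_op: "lin (gen_op g)"
  by (simp add: gen_op_def lin_lin_ext)

lemma lin_foldr_gen_op: "lin (foldr gen_op w)"
proof (induction w)
  case (Cons g w)
  then show ?case using lin_compose [OF lin_gen_op Cons] by (simp add: o_def)
qed (simp add: id_def lin_ident)

lemma lin_act_left: "lin (\<lambda>f. act f v)"
  unfolding act_def by (rule lin_lin_ext)

lemma act_word: "act (single w 1) v = foldr gen_op (letters w) v"
  by (simp add: act_def lin_ext_single)

lemma lin_act: "lin (act f)"
  unfolding act_def lin_ext_def
  by (rule linI) (simp_all add: lin_add [OF lin_foldr_gen_op] lin_scale [OF lin_foldr_gen_op]
      distrib_left sum.distrib sum_distrib_left mult.left_commute)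

text \<open>Concatenating words composes the operators, and both sides are linear in
  \<open>f\<close> and in \<open>g\<close>, so it suffices to treat words.\<close>

lemma act_mult: "act (f * g) v = act f (act g v)"
proof (rule lin_eqI [where f = f])
  fix w
  show "act (single w 1 * g) v = act (single w 1) (act g v)"
    by (rule lin_eqI [where f = g])
       (auto intro!: lin_compose [OF lin_act_left] lin_compose [OF lin_foldr_gen_op] lin_mult_left lin_ident
         simp: mult_single act_word plus_free_word_def)
qed (auto intro!: lin_compose [OF lin_act_left] lin_mult_right lin_ident)

lemma act_gen [simp]: "act (gen g) v = gen_op g v"
  by (simp add: gen_def act_word)

lemma act_scal [simp]: "act (scal c) v = single 0 c * v"
  by (simp add: scal_def act_def lin_ext_single zero_free_word_def)

lemma act_1 [simp]: "act 1 v = v"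
  using act_scal [of 1 v] by simp

lemma gen_op_single: "gen_op g (single k c) = single 0 c * basis_op g k"
  by (simp add: gen_op_def lin_ext_single)

text \<open>Since \<open>r\<close> is the inverse of \<open>p\<close>, multiplication by
  \<open>p ^ n\<close> reverses the order of the powers in the sum.\<close>

lemma geo_r_p: "p ^ n * geo r (Suc n) = geo p (Suc n)"
proof (induction n)
  case (Suc n)
  have "p ^ Suc n * geo r (Suc (Suc n)) = p ^ Suc n + (p * r) * (p ^ n * geo r (Suc n))"
    by (subst geo_Suc) (simp add: algebra_simps del: p_r)
  also have "\<dots> = geo p (Suc (Suc n))"
    by (simp add: Suc) (simp add: geo_def)
  finally show ?case .
qed (simp add: geo_def)


text \<open>Matches the terms with \<alpha>\<gamma> at \<open>(a - 2, b, c)\<close> that arise when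
  x and z both pass \<open>y^a\<close>.\<close>

lemma geo_cross: "geo p n * geo r (Suc n) = r * (geo r n * geo p (Suc n))"
proof (cases n)
  case (Suc m)
  then show ?thesis
    by (simp add: geo_r_p [symmetric] mult.assoc [symmetric])
qed simp

lemma p_r_cancel: "p * (r * x) = x" "r * (p * x) = x" "p ^ n * r ^ n = 1" "p ^ n * (r ^ n * x) = x"
  by (simp_all flip: mult.assoc power_mult_distrib)

lemmas op_simps = lin_add [OF lin_gen_op] lin_scale [OF lin_gen_op] lin_diff [OF lin_gen_op] gen_op_single
  lin_add [OF lin_act_left] lin_diff [OF lin_act_left] act_mult mult_single distrib_left

lemma act_XY: "act (gx * gy - (scal p * gy * gx + scal \<alpha>)) v = 0"
proof (rule lin_eqI [OF lin_act, where M = "\<lambda>_. 0"])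
  fix k :: "nat \<times> nat \<times> nat"
  obtain a b c where k: "k = (a, b, c)" by (metis prod_cases3)
  show "act (gx * gy - (scal p * gy * gx + scal \<alpha>)) (single k 1) = 0"
    unfolding k
    \<comment> \<open>After expansion both sides are compared coefficientwise; the split on
      \<open>a\<close> resolves the truncated \<open>a - 1\<close>.\<close>
    by (simp add: op_simps geo_Suc)
      (rule poly_mapping_eqI; cases a; simp add: lookup_add lookup_minus lookup_single when_def; auto simp: algebra_simps)
qed (simp add: lin_def)

lemma act_YZ: "act (gy * gz - (scal p * gz * gy + scal \<gamma>)) v = 0"
proof (rule lin_eqI [OF lin_act, where M = "\<lambda>_. 0"])
  fix k :: "nat \<times> nat \<times> nat"
  obtain a b c where k: "k = (a, b, c)" by (metis prod_cases3)
  show "act (gy * gz - (scal p * gz * gy + scal \<gamma>)) (single k 1) = 0"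
    unfolding k
    by (simp add: op_simps geo_Suc)
      (rule poly_mapping_eqI; cases a; simp add: lookup_add lookup_minus lookup_single when_def; auto simp: algebra_simps)
qed (simp add: lin_def)

text \<open>The main compatibility check. Since y acts by a plain shift, the relations involving y
  reduce to the recursion \<open>geo_Suc\<close>; here the corrections from moving x and z past
  \<open>y^a\<close> have to match, which also takes \<open>geo_cross\<close>.\<close>

lemma act_XZ: "act (gx * gz - (scal r * gz * gx + scal \<beta>)) v = 0"
proof (rule lin_eqI [OF lin_act, where M = "\<lambda>_. 0"])
  fix k :: "nat \<times> nat \<times> nat"
  obtain a b c where k: "k = (a, b, c)" by (metis prod_cases3)
  show "act (gx * gz - (scal r * gz * gx + scal \<beta>)) (single k 1) = 0"
    unfolding k
    by (simp add: op_simps geo_Suc)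
      (rule poly_mapping_eqI; cases a; cases b; simp add: lookup_add lookup_minus lookup_single when_def; auto simp: algebra_simps p_r_cancel geo_cross)
qed (simp add: lin_def)

text \<open>The elements that annihilate every vector form a two-sided ideal containing the
  relators, so it contains the ideal generated by them.\<close>

lemma act_mem:
  assumes "f \<in> I"
  shows "act f v = 0"
proof -
  let ?K = "{f :: 'k free3. \<forall>v. act f v = 0}"
  have "subgroup ?K (add_monoid free3_ring)"
  proof (rule subgroup.intro)
    show "inv\<^bsub>add_monoid free3_ring\<^esub> f \<in> ?K" if "f \<in> ?K" for f
      using that unfolding a_inv_def [symmetric] by (simp add: lin_uminus [OF lin_act_left])
  qed (auto simp: lin_0 [OF lin_act_left] lin_add [OF lin_act_left])
  then have "ideal ?K free3_ring"
    by (rule idealI [OF ring_free3_ring]) (auto simp: act_mult lin_0 [OF lin_act])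
  moreover have "weyl_relators q \<alpha> \<beta> \<gamma> \<subseteq> ?K"
    using act_XY act_XZ act_YZ by (auto simp: weyl_relators_def p_def r_def)
  ultimately have "I \<subseteq> ?K"
    unfolding weyl_ideal_def by (rule ring.genideal_minimal [OF ring_free3_ring])
  with assms show ?thesis by blast
qed

section \<open>Normal forms in the ordered monomials\<close>

definition coords :: "'k free3 \<Rightarrow> (nat \<times> nat \<times> nat \<Rightarrow>\<^sub>0 'k)" where
  "coords f = act f (single 0 1)"

fun mon :: "nat \<times> nat \<times> nat \<Rightarrow> 'k free3" where
  "mon (a, b, c) = gy ^ a * gx ^ b * gz ^ c"

definition of_coords :: "(nat \<times> nat \<times> nat \<Rightarrow>\<^sub>0 'k) \<Rightarrow> 'k free3" where
  "of_coords = lin_ext mon"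

lemma lin_coords: "lin coords"
  unfolding coords_def by (rule lin_act_left)

lemma lin_of_coords: "lin of_coords"
  unfolding of_coords_def by (rule lin_lin_ext)

lemma coords_cong: "f \<doteq> g \<Longrightarrow> coords f = coords g"
  using act_mem [of "f - g"] by (simp add: congr_def coords_def lin_diff [OF lin_act_left])

lemma of_coords_single: "of_coords (single k c) = scal c * mon k"
  by (simp add: of_coords_def lin_ext_single scal_def)

text \<open>Confirms that \<open>basis_op\<close> describes left multiplication in the algebra
  itself: x is moved past \<open>y^a\<close>, and z past \<open>y^a\<close> and then past
  \<open>x^b\<close>.\<close>

lemma gen_mon: "gen g * mon k \<doteq> of_coords (basis_op g k)"
proof -
  obtain a b c where k: "k = (a, b, c)" by (metis prod_cases3)
  show ?thesis
  proof (cases g)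
    case GX
    have "gx * mon k = (gx * gy ^ a) * (gx ^ b * gz ^ c)"
      by (simp add: k mult.assoc)
    also have "\<dots> \<doteq> (scal (p ^ a) * (gy ^ a * gx) + scal (\<alpha> * geo p a) * gy ^ (a - 1)) * (gx ^ b * gz ^ c)"
      by (intro cong_mult cong_power_right XY cong_refl)
    also have "\<dots> = of_coords (basis_op GX k)"
      by (simp add: k lin_add [OF lin_of_coords] of_coords_single distrib_right mult.assoc)
    finally show ?thesis by (simp add: GX)
  next
    case GY
    then show ?thesis by (simp add: k of_coords_single mult.assoc)
  next
    case GZ
    let ?s = "scal (- (r * \<gamma>) * geo r a)" and ?t = "scal (- (p * \<beta>) * geo p b)"
    have "gz * mon k = (gz * gy ^ a) * (gx ^ b * gz ^ c)"
      by (simp add: k mult.assoc)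
    also have "\<dots> \<doteq> (scal (r ^ a) * (gy ^ a * gz) + ?s * gy ^ (a - 1)) * (gx ^ b * gz ^ c)"
      by (intro cong_mult cong_power_right ZY cong_refl)
    also have "\<dots> = scal (r ^ a) * (gy ^ a * ((gz * gx ^ b) * gz ^ c)) + ?s * (gy ^ (a - 1) * (gx ^ b * gz ^ c))"
      by (simp add: distrib_right mult.assoc)
    also have "\<dots> \<doteq> scal (r ^ a) * (gy ^ a * ((scal (p ^ b) * (gx ^ b * gz) + ?t * gx ^ (b - 1)) * gz ^ c))
        + ?s * (gy ^ (a - 1) * (gx ^ b * gz ^ c))"
      by (intro cong_mult cong_add cong_power_right ZX cong_refl)
    also have "\<dots> = of_coords (basis_op GZ k)"
      by (simp add: k lin_add [OF lin_of_coords] of_coords_single distrib_right distrib_left mult.assoc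
          scal_left_commute [of "gy ^ a"] scal_mult scal_uminus right_diff_distrib left_diff_distrib)
    finally show ?thesis by (simp add: GZ)
  qed
qed

lemma lin_ext_mem: "(\<And>k. k \<in> keys v \<Longrightarrow> h k \<in> I) \<Longrightarrow> lin_ext h v \<in> I"
proof -
  assume h: "\<And>k. k \<in> keys v \<Longrightarrow> h k \<in> I"
  have "(\<Sum>k\<in>A. single 0 (lookup v k) * h k) \<in> I" if "A \<subseteq> keys v" for A
    using finite_subset [OF that finite_keys] that
    by (induction A rule: finite_induct) (auto simp: zero_mem intro!: add_mem mult_left_mem h)
  then show ?thesis by (simp add: lin_ext_def)
qed

lemma lin_cong:
  assumes "lin L" "lin M" "\<And>k. L (single k 1) \<doteq> M (single k 1)"
  shows "L v \<doteq> M v"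
proof -
  have "L v - M v = lin_ext (\<lambda>k. L (single k 1) - M (single k 1)) v"
    by (rule lin_conv_lin_ext [OF lin_minus [OF assms(1,2)]])
  also have "\<dots> \<in> I"
    using assms(3) by (intro lin_ext_mem) (simp add: congr_def)
  finally show ?thesis by (simp add: congr_def)
qed

lemma gen_of_coords: "gen g * of_coords v \<doteq> of_coords (gen_op g v)"
  by (rule lin_cong [OF lin_compose [OF lin_mult_left lin_of_coords] lin_compose [OF lin_of_coords lin_gen_op]])
    (simp add: of_coords_single gen_op_single gen_mon)

lemma word_Cons: "single (Word (g # w)) 1 = gen g * single (Word w) 1"
  by (simp add: gen_def mult_single plus_free_word_def)

lemma word_Nil: "single (Word []) 1 = 1"
  by (simp add: zero_free_word_def [symmetric])

text \<open>The spanning half of the Poincare-Birkhoff-Witt property, by adding one letter at a time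
  to a word and extending linearly.\<close>

lemma normal_form: "f \<doteq> of_coords (coords f)"
proof (rule lin_cong [OF lin_ident lin_compose [OF lin_of_coords lin_coords]])
  fix w :: "gen3 free_word"
  have "single (Word w) 1 \<doteq> of_coords (coords (single (Word w) 1))" for w
  proof (induction w)
    case Nil
    then show ?case by (simp add: word_Nil coords_def of_coords_single zero_prod_def)
  next
    case (Cons g w)
    have "single (Word (g # w)) 1 \<doteq> gen g * of_coords (coords (single (Word w) 1))"
      unfolding word_Cons by (intro cong_mult Cons cong_refl)
    also have "\<dots> \<doteq> of_coords (gen_op g (coords (single (Word w) 1)))"
      by (rule gen_of_coords)
    also have "\<dots> = of_coords (coords (single (Word (g # w)) 1))"
      by (simp add: word_Cons coords_def act_mult)
    finally show ?case .
  qed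
  from this [of "letters w"] show "single w 1 \<doteq> of_coords (coords (single w 1))" by simp
qed

text \<open>The module makes \<open>coords\<close> an invariant of the congruence class, and
  \<open>normal_form\<close> makes it a complete one.\<close>

lemma cong_iff: "f \<doteq> g \<longleftrightarrow> coords f = coords g"
  using normal_form coords_cong by (metis cong_sym cong_trans)

subsection \<open>Leading terms\<close>

fun total_degree :: "nat \<times> nat \<times> nat \<Rightarrow> nat" where
  "total_degree (a, b, c) = a + b + c"

text \<open>The degree bound is strict, so \<open>low 0\<close> forces the zero vector; this starts
  the induction in \<open>central_in_B\<close>.\<close>

definition low :: "nat \<Rightarrow> (nat \<times> nat \<times> nat \<Rightarrow>\<^sub>0 'k) \<Rightarrow> bool" where
  "low n v \<longleftrightarrow> (\<forall>k. n \<le> total_degree k \<longrightarrow> lookup v k = 0)"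

lemma low_0 [simp]: "low n 0"
  by (simp add: low_def)

lemma low_add: "low n u \<Longrightarrow> low n v \<Longrightarrow> low n (u + v)"
  by (simp add: low_def lookup_add)

lemma low_scale: "low n v \<Longrightarrow> low n (single 0 c * v)"
  by (simp add: low_def lookup_single_0_mult)

lemma low_mono: "low m v \<Longrightarrow> m \<le> n \<Longrightarrow> low n v"
  by (auto simp: low_def)

lemma low_single: "total_degree k < n \<or> c = 0 \<Longrightarrow> low n (single k c)"
  by (auto simp: low_def lookup_single when_def)

lemma low_lin_ext: "(\<And>k. k \<in> keys v \<Longrightarrow> low n (h k)) \<Longrightarrow> low n (lin_ext h v)"
  by (auto simp: low_def lookup_lin_ext intro!: sum.neutral)

fun shift :: "gen3 \<Rightarrow> nat \<times> nat \<times> nat \<Rightarrow> nat \<times> nat \<times> nat" where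
  "shift GY (a, b, c) = (Suc a, b, c)"
| "shift GX (a, b, c) = (a, Suc b, c)"
| "shift GZ (a, b, c) = (a, b, Suc c)"

fun weight :: "gen3 \<Rightarrow> nat \<times> nat \<times> nat \<Rightarrow> 'k" where
  "weight GY (a, b, c) = 1"
| "weight GX (a, b, c) = p ^ a"
| "weight GZ (a, b, c) = r ^ a * p ^ b"

lemma low_basis_op: "low (Suc (total_degree k)) (basis_op g k - single (shift g k) (weight g k))"
  by (cases k; cases g) (auto intro!: low_add low_single)

lemma total_degree_shift [simp]: "total_degree (shift g k) = Suc (total_degree k)"
  by (cases k; cases g) auto

lemma shift_inject [simp]: "shift g k = shift g k' \<longleftrightarrow> k = k'"
  by (cases k; cases k'; cases g) auto

lemma low_gen_op: 
  assumes "low n v"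
  shows "low (Suc n) (gen_op g v)"
  unfolding gen_op_def
proof (rule low_lin_ext)
  fix k assume "k \<in> keys v"
  then have k: "total_degree k < n"
    using assms by (metis in_keys_iff low_def not_le)
  have "low (Suc n) (basis_op g k - single (shift g k) (weight g k) + single (shift g k) (weight g k))"
    using k by (intro low_add low_single low_mono [OF low_basis_op]) auto
  then show "low (Suc n) (basis_op g k)" by simp
qed

fun multidegree :: "gen3 list \<Rightarrow> nat \<times> nat \<times> nat" where
  "multidegree [] = 0"
| "multidegree (g # w) = shift g (multidegree w)"

text \<open>The power of \<open>p\<close>, possibly with negative exponent, that is collected when
  the word is sorted into the form \<open>y^a x^b z^c\<close> and terms of lower degree are
  dropped.\<close>

fun lead_scalar :: "gen3 list \<Rightarrow> 'k" where
  "lead_scalar [] = 1"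
| "lead_scalar (g # w) = weight g (multidegree w) * lead_scalar w"

lemma total_degree_multidegree [simp]: "total_degree (multidegree w) = length w"
  by (induction w) (simp_all add: zero_prod_def)

lemma lead_scalar_nonzero: "lead_scalar w \<noteq> 0"
proof (induction w)
  case (Cons g w)
  have "weight g k \<noteq> 0" for k
    by (cases k; cases g) (auto simp: r_def)
  with Cons show ?case by simp
qed simp

lemma low_coords_word: "low (length w) (coords (single (Word w) 1) - single (multidegree w) (lead_scalar w))"
proof (induction w)
  case Nil
  then show ?case by (simp add: word_Nil coords_def)
next
  case (Cons g w)
  let ?v = "coords (single (Word w) 1)" and ?k = "multidegree w"
  \<comment> \<open>The error splits into the operator applied to the previous error and the error
    of the operator on the leading monomial.\<close>
  have "coords (single (Word (g # w)) 1) - single (multidegree (g # w)) (lead_scalar (g # w)) =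
      gen_op g (?v - single ?k (lead_scalar w))
      + single 0 (lead_scalar w) * (basis_op g ?k - single (shift g ?k) (weight g ?k))"
    by (simp add: word_Cons coords_def act_mult lin_diff [OF lin_gen_op] gen_op_single right_diff_distrib mult_single mult.commute)
  also have "low (length (g # w)) \<dots>"
    using low_gen_op [OF Cons] low_basis_op [of ?k g] by (auto intro!: low_add low_scale)
  finally show ?case .
qed

section \<open>Top-degree terms of commutators with a generator\<close>

lemma multidegree_snoc: "multidegree (w @ [g]) = shift g (multidegree w)"
proof (induction w)
  case (Cons h w)
  have "shift h (shift g k) = shift g (shift h k)" for k
    by (cases k; cases g; cases h) auto
  with Cons show ?case by simp
qed simp

text \<open>An appended x has to pass \<open>z^c\<close>, at the cost of \<open>p ^ c\<close>. An
  appended y has to pass \<open>z^c\<close> and \<open>x^b\<close>, at the cost of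
  \<open>r ^ c * p ^ b\<close>; the factor \<open>p ^ c\<close> on the left clears the inverse
  power.\<close>

lemma lead_scalar_snoc:
  assumes "multidegree w = (a, b, c)"
  shows "lead_scalar (w @ [GX]) = p ^ c * lead_scalar w"
    and "p ^ c * lead_scalar (w @ [GY]) = p ^ b * lead_scalar w"
proof -
  have "lead_scalar (w @ [GX]) = p ^ c * lead_scalar w \<and> p ^ c * lead_scalar (w @ [GY]) = p ^ b * lead_scalar w"
    using assms
  proof (induction w arbitrary: a b c)
    case Nil
    then show ?case by (simp add: zero_prod_def)
  next
    case (Cons g w)
    obtain a' b' c' where w: "multidegree w = (a', b', c')" by (metis prod_cases3)
    from Cons.IH [OF this] Cons.prems w show ?case
      by (cases g) (auto simp: multidegree_snoc mult_ac p_r_cancel)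
  qed
  then show "lead_scalar (w @ [GX]) = p ^ c * lead_scalar w"
    and "p ^ c * lead_scalar (w @ [GY]) = p ^ b * lead_scalar w" by auto
qed

fun mon_word :: "nat \<times> nat \<times> nat \<Rightarrow> gen3 list" where
  "mon_word (a, b, c) = replicate a GY @ replicate b GX @ replicate c GZ"

lemma multidegree_mon_word [simp]: "multidegree (mon_word k) = k"
proof -
  obtain a b c where k: "k = (a, b, c)" by (metis prod_cases3)
  have "multidegree (replicate c GZ) = (0, 0, c)" for c
    by (induction c) (simp_all add: zero_prod_def)
  then have "multidegree (replicate b GX @ replicate c GZ) = (0, b, c)" for b
    by (induction b) simp_all
  then have "multidegree (replicate a GY @ replicate b GX @ replicate c GZ) = (a, b, c)" for a
    by (induction a) simp_all
  then show ?thesis by (simp add: k)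
qed

lemma word_append: "single (Word (v @ w)) 1 = single (Word v) 1 * (single (Word w) 1 :: 'k free3)"
  by (simp add: mult_single plus_free_word_def)

lemma mon_conv_word: "mon k = single (Word (mon_word k)) 1"
proof -
  have "gen g ^ n = (single (Word (replicate n g)) 1 :: 'k free3)" for g n
    by (induction n) (simp_all add: word_Nil word_Cons)
  then show ?thesis by (cases k) (simp add: word_append mult.assoc)
qed

text \<open>Both products have their only possible top term at \<open>shift g k\<close>. By
  injectivity of \<open>shift g\<close>, a monomial of degree at most that of \<open>t\<close>
  reaches \<open>shift g t\<close> only if it is \<open>t\<close>.\<close>

lemma lookup_commutator_mon:
  assumes "total_degree k \<le> total_degree t"
  shows "lookup (coords (gen g * mon k - mon k * gen g)) (shift g t) =
    (if k = t then lead_scalar (g # mon_word t) - lead_scalar (mon_word t @ [g]) else 0)"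
proof -
  let ?w = "mon_word k"
  have len: "length ?w = total_degree k"
    by (metis multidegree_mon_word total_degree_multidegree)
  have *: "lookup (coords (single (Word v) 1)) (shift g t) = (lead_scalar v when k = t)"
    if "length v = Suc (total_degree k)" "multidegree v = shift g k" for v
  proof -
    have "lookup (coords (single (Word v) 1) - single (shift g k) (lead_scalar v)) (shift g t) = 0"
      using low_coords_word [of v] that assms by (metis Suc_le_mono low_def total_degree_shift)
    then show ?thesis by (auto simp: lookup_minus lookup_single when_def)
  qed
  have "gen g * mon k - mon k * gen g = single (Word (g # ?w)) 1 - single (Word (?w @ [g])) 1"
    by (simp add: mon_conv_word word_Cons word_append word_Nil)
  then show ?thesis
    using len by (simp add: lin_diff [OF lin_coords] lookup_minus * multidegree_snoc when_def del: lead_scalar.simps)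
qed

text \<open>The coefficient of the vanishing commutator at \<open>shift g t\<close> receives a
  contribution from the monomial \<open>t\<close> alone, so the two scalars for \<open>t\<close>
  must agree.\<close>

lemma central_weight:
  assumes "gen g * f \<doteq> f * gen g" and "low (Suc (total_degree t)) (coords f)" and "lookup (coords f) t \<noteq> 0"
  shows "lead_scalar (g # mon_word t) = lead_scalar (mon_word t @ [g])"
proof -
  let ?v = "coords f" and ?L = "\<lambda>v. coords (gen g * of_coords v - of_coords v * gen g)"
  have lin: "lin ?L"
    by (intro lin_compose [OF lin_coords] lin_minus lin_compose [OF lin_mult_left lin_of_coords]
        lin_compose [OF lin_mult_right lin_of_coords])
  \<comment> \<open>Replacing \<open>f\<close> by its normal form makes the commutator a linear
    function of \<open>coords f\<close>.\<close>
  have "gen g * of_coords ?v \<doteq> gen g * f" "f * gen g \<doteq> of_coords ?v * gen g"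
    by (intro cong_mult cong_refl normal_form cong_sym [OF normal_form])+
  with assms(1) have "gen g * of_coords ?v \<doteq> of_coords ?v * gen g"
    by (metis cong_trans)
  then have "?L ?v = 0"
    by (simp add: lin_diff [OF lin_coords] coords_cong)
  then have "0 = lookup (lin_ext (\<lambda>k. ?L (single k 1)) ?v) (shift g t)"
    by (simp add: lin_conv_lin_ext [OF lin, symmetric])
  also have "\<dots> = (\<Sum>k\<in>keys ?v. lookup ?v k * lookup (coords (gen g * mon k - mon k * gen g)) (shift g t))"
    by (simp add: lookup_lin_ext of_coords_single)
  also have "\<dots> = (\<Sum>k\<in>keys ?v. if k = t then lookup ?v t * (lead_scalar (g # mon_word t) - lead_scalar (mon_word t @ [g])) else 0)"
  proof (rule sum.cong [OF refl])
    fix k assume "k \<in> keys ?v"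
    then have "total_degree k \<le> total_degree t"
      using assms(2) by (metis in_keys_iff low_def not_less_eq_eq)
    then show "lookup ?v k * lookup (coords (gen g * mon k - mon k * gen g)) (shift g t) =
      (if k = t then lookup ?v t * (lead_scalar (g # mon_word t) - lead_scalar (mon_word t @ [g])) else 0)"
      by (simp add: lookup_commutator_mon del: lead_scalar.simps)
  qed
  also have "\<dots> = lookup ?v t * (lead_scalar (g # mon_word t) - lead_scalar (mon_word t @ [g]))"
    using assms(3) by (simp add: in_keys_iff del: lead_scalar.simps)
  finally show ?thesis using assms(3) by (simp del: lead_scalar.simps)
qed

text \<open>Multiplying by x on the left and on the right compares \<open>p ^ a\<close> with
  \<open>p ^ c\<close>; doing so with y compares 1 with \<open>r ^ c * p ^ b\<close>.\<close>

lemma central_exponents: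
  assumes "\<And>g. gen g * f \<doteq> f * gen g" and "low (Suc (a + b + c)) (coords f)" and "lookup (coords f) (a, b, c) \<noteq> 0"
  shows "p ^ a = p ^ c" and "p ^ b = p ^ c"
proof -
  let ?w = "mon_word (a, b, c)"
  note w = lead_scalar_snoc [OF multidegree_mon_word [of "(a, b, c)"]]
  have *: "lead_scalar (g # ?w) = lead_scalar (?w @ [g])" for g
    using assms by (intro central_weight [where f = f]) auto
  have "p ^ a * lead_scalar ?w = p ^ c * lead_scalar ?w"
    using * [of GX] w(1) by (simp del: mon_word.simps add: multidegree_mon_word)
  then show "p ^ a = p ^ c" by (simp add: lead_scalar_nonzero del: mon_word.simps)
  have "p ^ c * lead_scalar ?w = p ^ b * lead_scalar ?w"
    using * [of GY] w(2) by (simp del: mon_word.simps add: multidegree_mon_word)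
  then show "p ^ b = p ^ c" by (simp add: lead_scalar_nonzero del: mon_word.simps)
qed

section \<open>Leading words in the free algebra\<close>

definition short :: "nat \<Rightarrow> 'k free3 \<Rightarrow> bool" where
  "short n f \<longleftrightarrow> (\<forall>w. n \<le> length (letters w) \<longrightarrow> lookup f w = 0)"

lemma short_add: "short n f \<Longrightarrow> short n g \<Longrightarrow> short n (f + g)"
  by (simp add: short_def lookup_add)

lemma short_diff: "short n f \<Longrightarrow> short n g \<Longrightarrow> short n (f - g)"
  by (simp add: short_def lookup_minus)

lemma short_mono: "short m f \<Longrightarrow> m \<le> n \<Longrightarrow> short n f"
  by (auto simp: short_def)

lemma short_single: "length (letters w) < n \<Longrightarrow> short n (single w c)"
  by (auto simp: short_def lookup_single when_def)

text \<open>With \<open>Suc m\<close> the first factor has words of length at most \<open>m\<close>,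
  so adding the strict bound \<open>n\<close> of the second gives the strict bound
  \<open>m + n\<close>.\<close>

lemma short_mult:
  assumes "short (Suc m) f" "short n g"
  shows "short (m + n) (f * g)"
  unfolding short_def
proof (intro allI impI)
  fix w :: "gen3 free_word" assume w: "m + n \<le> length (letters w)"
  show "lookup (f * g) w = 0"
  proof (rule ccontr)
    assume "lookup (f * g) w \<noteq> 0"
    then have "w \<in> keys (f * g)" by (simp add: in_keys_iff)
    then obtain u v where uv: "w = u + v" "u \<in> keys f" "v \<in> keys g"
      using keys_mult [of f g] by blast
    then have "length (letters u) < Suc m" "length (letters v) < n"
      using assms by (metis in_keys_iff short_def not_le)+
    with w uv(1) show False by (simp add: plus_free_word_def)
  qed
qed

lemma short_mult_word: "short m f \<Longrightarrow> short (m + length w) (f * single (Word w) 1)"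
proof (cases m)
  case 0
  moreover assume "short m f"
  ultimately have "f = 0" by (intro poly_mapping_eqI) (simp add: short_def)
  then show ?thesis by (simp add: short_def)
next
  case (Suc m')
  moreover assume "short m f"
  ultimately show ?thesis
    using short_mult [of m' f "Suc (length w)" "single (Word w) 1"] by (simp add: short_single)
qed

text \<open>Sorting a word never yields a degree above its length. Estimates for products can thus
  be made in the free algebra, where lengths add, and then transferred.\<close>

lemma low_coords: 
  assumes "short n f"
  shows "low n (coords f)"
  unfolding lin_conv_lin_ext [OF lin_coords, of f]
proof (rule low_lin_ext)
  fix w assume "w \<in> keys f"
  then have w: "length (letters w) < n"
    using assms by (metis in_keys_iff short_def not_le)
  let ?s = "single (multidegree (letters w)) (lead_scalar (letters w))"
  have "low n (coords (single w 1) - ?s)"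
    using low_mono [OF low_coords_word [of "letters w"], of n] w by simp
  then have "low n (coords (single w 1) - ?s + ?s)"
    by (rule low_add) (use w in \<open>simp add: low_single\<close>)
  then show "low n (coords (single w 1))" by simp
qed

text \<open>The top part must be one word with coefficient 1, its letters in any order. This is
  stable under products without tracking scalars; sorting then costs a nonzero scalar, see
  \<open>leads_coords\<close>.\<close>

definition leads :: "'k free3 \<Rightarrow> nat \<times> nat \<times> nat \<Rightarrow> bool" where
  "leads f t \<longleftrightarrow> (\<exists>w. multidegree w = t \<and> short (length w) (f - single (Word w) 1))"

lemma leads_1: "leads 1 0"
  unfolding leads_def by (rule exI [of _ "[]"]) (simp add: word_Nil short_def)

lemma leads_gen: "leads (gen g) (shift g 0)"
  unfolding leads_def by (rule exI [of _ "[g]"]) (simp add: word_Nil word_Cons short_def)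

lemma shift_add: "shift g (k + t) = shift g k + t"
  by (cases g; cases k; cases t) auto

lemma multidegree_append: "multidegree (v @ w) = multidegree v + multidegree w"
  by (induction v) (simp_all add: shift_add)

lemma leads_mult:
  assumes "leads f s" "leads g t"
  shows "leads (f * g) (s + t)"
proof -
  obtain v w where v: "multidegree v = s" "short (length v) (f - single (Word v) 1)"
    and w: "multidegree w = t" "short (length w) (g - single (Word w) 1)"
    using assms by (auto simp: leads_def)
  let ?v = "single (Word v) 1 :: 'k free3" and ?w = "single (Word w) 1 :: 'k free3"
  have "short (Suc (length v)) ((f - ?v) + ?v)"
    using v(2) by (intro short_add short_single) (auto elim: short_mono)
  then have "short (length v + length w) (f * (g - ?w))"
    using w(2) by (intro short_mult) simp_all
  then have "short (length v + length w) (f * (g - ?w) + (f - ?v) * ?w)"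
    using v(2) by (intro short_add short_mult_word)
  \<comment> \<open>The error of the product telescopes into one error term from each
    factor.\<close>
  moreover have "f * (g - ?w) + (f - ?v) * ?w = f * g - single (Word (v @ w)) 1"
    by (simp add: word_append algebra_simps)
  ultimately show ?thesis
    unfolding leads_def using v w by (intro exI [of _ "v @ w"]) (simp add: multidegree_append)
qed

lemma leads_power: "leads f (a, b, c) \<Longrightarrow> leads (f ^ n) (n * a, n * b, n * c)"
proof (induction n)
  case (Suc n)
  then show ?case using leads_mult [of f _ "f ^ n"] by fastforce
qed (use leads_1 in \<open>simp add: zero_prod_def\<close>)

lemma leads_coords:
  assumes "leads f t"
  obtains c where "c \<noteq> 0" "low (total_degree t) (coords f - single t c)"
proof -
  obtain w where w: "multidegree w = t" "short (length w) (f - single (Word w) 1)"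
    using assms by (auto simp: leads_def)
  let ?w = "single (Word w) 1 :: 'k free3"
  have "low (length w) (coords (f - ?w) + (coords ?w - single t (lead_scalar w)))"
    using w low_coords low_coords_word [of w] by (auto intro: low_add)
  then show ?thesis
    using that [of "lead_scalar w"] w(1) total_degree_multidegree [of w]
    by (simp add: lin_diff [OF lin_coords] lead_scalar_nonzero)
qed

subsection \<open>Central elements\<close>

definition central :: "'k free3 \<Rightarrow> bool" where
  "central f \<longleftrightarrow> (\<forall>g. gen g * f \<doteq> f * gen g)"

lemma central_scal: "central (scal c)"
  by (simp add: central_def scal_commute)

lemma central_add: "central f \<Longrightarrow> central g \<Longrightarrow> central (f + g)"
  by (auto simp: central_def distrib_left distrib_right intro!: cong_add)

lemma central_uminus: "central f \<Longrightarrow> central (- f)"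
  using cong_uminus by (fastforce simp: central_def)

lemma central_diff: "central f \<Longrightarrow> central g \<Longrightarrow> central (f - g)"
  using central_add [of f "- g"] central_uminus [of g] by simp

lemma central_mult:
  assumes "central f" "central g"
  shows "central (f * g)"
  unfolding central_def
proof
  fix x
  have "gen x * (f * g) = (gen x * f) * g" by (simp add: mult.assoc)
  also have "\<dots> \<doteq> (f * gen x) * g"
    using assms(1) by (intro cong_mult [OF _ cong_refl]) (simp add: central_def)
  also have "\<dots> = f * (gen x * g)" by (simp add: mult.assoc)
  also have "\<dots> \<doteq> f * (g * gen x)"
    using assms(2) by (intro cong_mult [OF cong_refl]) (simp add: central_def)
  also have "\<dots> = (f * g) * gen x" by (simp add: mult.assoc)
  finally show "gen x * (f * g) \<doteq> (f * g) * gen x" .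
qed

lemma central_power: "central f \<Longrightarrow> central (f ^ n)"
  using central_scal [of 1] by (induction n) (auto intro: central_mult)

lemma central_sum: "(\<And>k. k \<in> A \<Longrightarrow> central (f k)) \<Longrightarrow> central (sum f A)"
  using central_scal [of 0] by (induction A rule: infinite_finite_induct) (auto intro: central_add)

text \<open>Commuting with the generators passes to words by induction and to all elements by
  linearity.\<close>

lemma central_commute:
  assumes "central f"
  shows "h * f \<doteq> f * h"
proof (rule lin_cong [OF lin_mult_right lin_mult_left])
  fix w :: "gen3 free_word"
  have "single (Word w) 1 * f \<doteq> f * single (Word w) 1" for w
  proof (induction w)
    case (Cons g w)
    let ?w = "single (Word w) 1 :: 'k free3"
    have "gen g * ?w * f = gen g * (?w * f)" by (simp add: mult.assoc)
    also have "\<dots> \<doteq> gen g * (f * ?w)" by (intro cong_mult Cons cong_refl)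
    also have "\<dots> = (gen g * f) * ?w" by (simp add: mult.assoc)
    also have "\<dots> \<doteq> (f * gen g) * ?w"
      using assms by (intro cong_mult [OF _ cong_refl]) (simp add: central_def)
    also have "\<dots> = f * (gen g * ?w)" by (simp add: mult.assoc)
    finally show ?case by (simp add: word_Cons)
  qed (simp add: word_Nil)
  from this [of "letters w"] show "single w 1 * f \<doteq> f * single w 1" by simp
qed

definition Om :: "'k free3" where
  "Om = gy * gx * gz + scal (r * \<gamma> / (p - 1)) * gx - scal (p * \<beta> / (p - 1)) * gy + scal (\<alpha> / (p - 1)) * gz"

lemma leads_Om: "leads Om (1, 1, 1)"
proof -
  have *: "short 3 (scal c * gen g)" for c g
    by (simp add: scal_def gen_def mult_single short_single)
  have "short 3 (scal (r * \<gamma> / (p - 1)) * gx - scal (p * \<beta> / (p - 1)) * gy + scal (\<alpha> / (p - 1)) * gz)"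
    by (intro short_add short_diff *)
  then show ?thesis
    unfolding leads_def by (intro exI [of _ "[GY, GX, GZ]"])
      (simp add: Om_def word_Cons word_Nil zero_prod_def mult.assoc numeral_3_eq_3)
qed

lemma central_Om:
  assumes "p \<noteq> 1"
  shows "central Om"
  unfolding central_def
proof
  fix g
  have p: "p - 1 \<noteq> 0" using assms by simp
  \<comment> \<open>By \<open>cong_iff\<close> it is enough to compare two explicit vectors,
    obtained by applying the operators to the basis vector \<open>(0, 0, 0)\<close>.\<close>
  have "coords (gen g * Om) = coords (Om * gen g)"
    using p
    by (cases g; simp add: coords_def Om_def op_simps distrib_right left_diff_distrib right_diff_distrib
          zero_prod_def geo_Suc)
      (rule poly_mapping_eqI; simp add: lookup_add lookup_minus lookup_single when_def; auto simp: field_simps r_def)+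
  then show "gen g * Om \<doteq> Om * gen g" by (simp add: cong_iff)
qed

subsection \<open>The quotient algebra\<close>

abbreviation "A \<equiv> weyl_algebra q \<alpha> \<beta> \<gamma>"
abbreviation "cl \<equiv> weyl_class q \<alpha> \<beta> \<gamma>"

lemma carrier_A: "carrier A = range cl"
  by (auto simp: weyl_algebra_def FactRing_def A_RCOSETS_def' weyl_class_def)

lemma cl_eq_iff: "cl f = cl g \<longleftrightarrow> f \<doteq> g"
proof -
  interpret J: ideal I free3_ring by (rule ideal_weyl_ideal)
  have "f \<in> cl g \<longleftrightarrow> f \<doteq> g"
    using J.a_rcos_module_minus [OF J.ring_axioms, where x = g and x' = f]
    by (simp add: weyl_class_def congr_def a_minus_def)
  then show ?thesis
    using J.a_repr_independence' [of f g] J.a_rcos_self [of f]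
    by (auto simp: weyl_class_def)
qed

lemma cl_hom: "cl \<in> ring_hom free3_ring A"
  using ideal.rcos_ring_hom [OF ideal_weyl_ideal]
  by (simp add: weyl_algebra_def weyl_class_def [abs_def])

lemma cl_add: "cl f \<oplus>\<^bsub>A\<^esub> cl g = cl (f + g)"
  and cl_mult: "cl f \<otimes>\<^bsub>A\<^esub> cl g = cl (f * g)"
  and cl_one: "\<one>\<^bsub>A\<^esub> = cl 1"
  using ring_hom_add [OF cl_hom] ring_hom_mult [OF cl_hom] ring_hom_one [OF cl_hom] by auto

lemma cl_uminus: "\<ominus>\<^bsub>A\<^esub> cl f = cl (- f)"
proof -
  interpret R: ring A by (rule ring_weyl_algebra)
  have "\<zero>\<^bsub>A\<^esub> = cl 0"
    using ring_hom_zero [OF cl_hom ring_free3_ring ring_weyl_algebra] by simp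
  then show ?thesis
    by (intro R.minus_equality) (auto simp: cl_add carrier_A)
qed

lemma cl_minus: "cl f \<ominus>\<^bsub>A\<^esub> cl g = cl (f - g)"
  by (simp add: a_minus_def cl_uminus cl_add)

lemma cl_power: "cl f [^]\<^bsub>A\<^esub> (n::nat) = cl (f ^ n)"
  by (induction n) (simp_all add: cl_one cl_mult power_commutes)

lemma cl_Om: "weyl_Omega q \<alpha> \<beta> \<gamma> = cl Om"
  by (simp add: weyl_Omega_def Let_def weyl_gen_def weyl_scal_def cl_add cl_mult cl_minus Om_def
      p_def r_def)

lemma center_A: "ring_center A = cl ` Collect central"
proof (intro equalityI subsetI)
  fix c assume "c \<in> ring_center A"
  then obtain f where f: "c = cl f" and "\<And>h. cl f \<otimes>\<^bsub>A\<^esub> cl h = cl h \<otimes>\<^bsub>A\<^esub> cl f"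
    by (auto simp: ring_center_def carrier_A)
  then have "f * h \<doteq> h * f" for h by (simp add: cl_mult cl_eq_iff)
  then have "central f" by (auto simp: central_def intro: cong_sym)
  then show "c \<in> cl ` Collect central" by (simp add: f)
next
  fix c assume "c \<in> cl ` Collect central"
  then show "c \<in> ring_center A"
    using cong_sym [OF central_commute] by (fastforce simp: ring_center_def carrier_A cl_mult cl_eq_iff)
qed

end

section \<open>The center when \<open>p\<close> is a primitive root of unity\<close>

locale weyl_root = weyl +
  fixes l :: nat
  assumes l_gt_1: "l > 1" and root: "primitive_root_of_unity l (q\<^sup>2)"
begin

lemma p_power_l: "p ^ l = 1" and r_power_l: "r ^ l = 1"
  using root by (simp_all add: primitive_root_of_unity_def p_def r_def power_inverse)

lemma p_neq_1: "p \<noteq> 1"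
  using root l_gt_1 unfolding primitive_root_of_unity_def p_def
  by (metis power_one_right zero_less_one)

lemma r_neq_1: "r \<noteq> 1"
  using p_neq_1 by (simp add: r_def)

lemma geo_l: "geo p l = 0" "geo r l = 0"
  using p_neq_1 r_neq_1 by (simp_all add: geo_def geometric_sum p_power_l r_power_l)

text \<open>In \<open>cong_power_right\<close> the factor becomes \<open>c ^ l = 1\<close> and the
  correction vanishes because \<open>geo c l = 0\<close>, for \<open>c\<close> equal to
  \<open>p\<close> or \<open>r\<close>.\<close>

lemma central_gen_power: "central (gen g ^ l)"
proof -
  have *: "a * b ^ l \<doteq> b ^ l * a" if "a * b \<doteq> scal c * (b * a) + scal d" "c = p \<or> c = r" for a b c d
    using cong_power_right [OF that(1), of l] that(2) by (auto simp: p_power_l r_power_l geo_l)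
  have "gen h * gen g ^ l \<doteq> gen g ^ l * gen h" for h
  proof (cases "h = g")
    case True
    then show ?thesis by (simp add: power_commutes)
  next
    case False
    then show ?thesis
      using * [OF XY] * [OF XZ] * [OF YZ] * [OF YX] * [OF ZX] * [OF ZY]
      by (cases g; cases h) auto
  qed
  then show ?thesis by (simp add: central_def)
qed

lemma dvd_diff_if_p_power_eq:
  assumes "p ^ i = p ^ j" "j \<le> i"
  shows "l dvd i - j"
proof -
  have "p ^ j * p ^ (i - j) = p ^ j * 1"
    using assms by (simp flip: power_add)
  then have 1: "p ^ (i - j) = 1" by simp
  have "p ^ ((i - j) mod l) = p ^ (l * ((i - j) div l) + (i - j) mod l)"
    by (simp only: power_add power_mult p_power_l power_one mult_1_left)
  also have "\<dots> = 1" using 1 by simp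
  finally have "p ^ ((i - j) mod l) = 1" .
  moreover have "(i - j) mod l < l" using l_gt_1 by simp
  ultimately have "(i - j) mod l = 0"
    using root unfolding primitive_root_of_unity_def p_def by (metis neq0_conv)
  then show ?thesis by (rule mod_0_imp_dvd)
qed

abbreviation "center_gens \<equiv> {cl (gx ^ l), cl (gy ^ l), cl (gz ^ l), cl Om}"
abbreviation "B \<equiv> weyl_subalgebra_generated q \<alpha> \<beta> \<gamma> center_gens"

lemma B_subset_center: "B \<subseteq> ring_center A"
proof
  fix h assume "h \<in> B"
  then show "h \<in> ring_center A"
    unfolding weyl_subalgebra_generated_def center_A
  proof induction
    case one
    then show ?case using central_scal [of 1] by (auto simp: cl_one)
  next
    case (incl h)
    then show ?case
      using central_gen_power central_Om [OF p_neq_1] central_scal by (auto simp: weyl_scal_def)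
  next
    case (a_inv h)
    then show ?case using central_uminus by (auto simp: cl_uminus)
  next
    case (eng_add h1 h2)
    then show ?case using central_add by (auto simp: cl_add)
  next
    case (eng_mult h1 h2)
    then show ?case using central_mult by (auto simp: cl_mult)
  qed
qed

lemma B_add: "cl f \<in> B \<Longrightarrow> cl g \<in> B \<Longrightarrow> cl (f + g) \<in> B"
  and B_mult: "cl f \<in> B \<Longrightarrow> cl g \<in> B \<Longrightarrow> cl (f * g) \<in> B"
  unfolding weyl_subalgebra_generated_def
  using generate_ring.eng_add [of "cl f" A _ "cl g"] generate_ring.eng_mult [of "cl f" A _ "cl g"]
  by (simp_all add: cl_add cl_mult)

lemma B_scal: "cl (scal c) \<in> B"
  and B_gen_power: "cl (gen g ^ l) \<in> B"
  and B_Om: "cl Om \<in> B"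
  unfolding weyl_subalgebra_generated_def
  by (cases g; auto simp: weyl_scal_def intro!: generate_ring.incl)+

lemma B_power: "cl f \<in> B \<Longrightarrow> cl (f ^ n) \<in> B"
  using B_scal [of 1] by (induction n) (auto intro: B_mult)

lemma B_sum: "(\<And>k. k \<in> T \<Longrightarrow> cl (f k) \<in> B) \<Longrightarrow> cl (sum f T) \<in> B"
  using B_scal [of 0] by (induction T rule: infinite_finite_induct) (auto intro: B_add)

lemma central_with_leading_monomial:
  assumes "p ^ a = p ^ c" "p ^ b = p ^ c"
  obtains h where "central h" "cl h \<in> B" "leads h (a, b, c)"
proof -
  define m where "m = min a (min b c)"
  have m: "m \<le> a" "m \<le> b" "m \<le> c" by (auto simp: m_def)
  \<comment> \<open>The minimum is one of the three exponents, and all of them give the same power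
    of \<open>p\<close>; hence \<open>l\<close> divides each difference below.\<close>
  have "p ^ m = p ^ c" unfolding m_def using assms by (simp add: min_def)
  then obtain i j k where ijk: "a - m = l * i" "b - m = l * j" "c - m = l * k"
    using assms m dvd_diff_if_p_power_eq by (metis dvdE)
  let ?h = "Om ^ m * (gy ^ l) ^ i * (gx ^ l) ^ j * (gz ^ l) ^ k"
  have "leads gy (1, 0, 0)" "leads gx (0, 1, 0)" "leads gz (0, 0, 1)"
    using leads_gen [of GY] leads_gen [of GX] leads_gen [of GZ] by (simp_all add: zero_prod_def)
  \<comment> \<open>The factors 1 and 0 are left unevaluated to match the shape of
    \<open>leads_power\<close>.\<close>
  then have "leads ?h ((m * 1, m * 1, m * 1) + (l * i * 1, l * i * 0, l * i * 0)
      + (l * j * 0, l * j * 1, l * j * 0) + (l * k * 0, l * k * 0, l * k * 1))"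
    unfolding power_mult [symmetric] by (intro leads_mult leads_power leads_Om)
  moreover have "a = m + l * i" "b = m + l * j" "c = m + l * k"
    using ijk m by linarith+
  ultimately have "leads ?h (a, b, c)" by simp
  moreover have "central ?h"
    by (intro central_mult central_power central_Om p_neq_1 central_gen_power)
  moreover have "cl ?h \<in> B"
    by (intro B_mult B_power B_Om B_gen_power)
  ultimately show ?thesis using that by blast
qed

text \<open>Induction on the degree bound: an element of \<open>B\<close> with the same coefficients
  in degree \<open>d\<close> is subtracted, which leaves a central element of smaller
  degree.\<close>

lemma central_in_B:
  assumes "central f" "low d (coords f)"
  shows "cl f \<in> B"
  using assms
proof (induction d arbitrary: f)
  case 0
  then have "coords f = 0" by (intro poly_mapping_eqI) (metis le0 low_def lookup_zero)
  then have "f \<doteq> scal 0" by (simp add: cong_iff lin_0 [OF lin_coords])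
  then show ?case using B_scal [of 0] cl_eq_iff by metis
next
  case (Suc d)
  let ?v = "coords f"
  define T where "T = {k \<in> keys ?v. total_degree k = d}"
  \<comment> \<open>The element and its leading coefficient are packed into a pair, so that both can
    be chosen at once as functions of \<open>k\<close>.\<close>
  have "\<exists>hc. central (fst hc) \<and> cl (fst hc) \<in> B \<and> snd hc \<noteq> 0 \<and>
      low d (coords (fst hc) - single k (snd hc))" if "k \<in> T" for k
  proof -
    obtain a b c where k: "k = (a, b, c)" by (metis prod_cases3)
    have "p ^ a = p ^ c" "p ^ b = p ^ c"
      using central_exponents [of f a b c] Suc.prems that by (auto simp: T_def k central_def in_keys_iff)
    then obtain h where "central h" "cl h \<in> B" "leads h k"
      unfolding k by (rule central_with_leading_monomial)
    moreover from this(3) obtain c where "c \<noteq> 0" "low (total_degree k) (coords h - single k c)"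
      by (rule leads_coords)
    ultimately show ?thesis
      using that by (intro exI [of _ "(h, c)"]) (simp add: T_def)
  qed
  then obtain hc where hc: "\<And>k. k \<in> T \<Longrightarrow> central (fst (hc k)) \<and> cl (fst (hc k)) \<in> B \<and> snd (hc k) \<noteq> 0 \<and>
      low d (coords (fst (hc k)) - single k (snd (hc k)))"
    by metis
  define h where "h = fst \<circ> hc"
  define c where "c = snd \<circ> hc"
  have h: "\<And>k. k \<in> T \<Longrightarrow> central (h k)" "\<And>k. k \<in> T \<Longrightarrow> cl (h k) \<in> B"
    and c: "\<And>k. k \<in> T \<Longrightarrow> c k \<noteq> 0" "\<And>k. k \<in> T \<Longrightarrow> low d (coords (h k) - single k (c k))"
    using hc by (simp_all add: h_def c_def)
  \<comment> \<open>Dividing by \<open>c k\<close> normalizes the leading coefficient of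
    \<open>h k\<close>, so the coefficient of \<open>t\<close> at \<open>k\<close> agrees with that
    of \<open>f\<close>.\<close>
  define t where "t = (\<Sum>k\<in>T. scal (lookup ?v k / c k) * h k)"
  have "central t"
    unfolding t_def by (intro central_sum central_mult central_scal h)
  have "cl t \<in> B"
    unfolding t_def by (intro B_sum B_mult B_scal h)
  have "low d (coords (f - t))"
    unfolding low_def
  proof (intro allI impI)
    fix k assume k: "d \<le> total_degree k"
    have "finite T" by (simp add: T_def)
    have "lookup (coords t) k = (\<Sum>k'\<in>T. lookup ?v k' / c k' * lookup (coords (h k')) k)"
      by (simp add: t_def lin_sum [OF lin_coords] scal_def lin_scale [OF lin_coords] lookup_sum lookup_single_0_mult)
    \<comment> \<open>In degrees from \<open>d\<close> upward each \<open>h k'\<close> has only its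
      leading term, so the summands do not interfere.\<close>
    also have "\<dots> = (\<Sum>k'\<in>T. if k' = k then lookup ?v k else 0)"
    proof (rule sum.cong [OF refl])
      fix k' assume "k' \<in> T"
      then have "c k' \<noteq> 0" "lookup (coords (h k') - single k' (c k')) k = 0"
        using c [of k'] k unfolding low_def by blast+
      then show "lookup ?v k' / c k' * lookup (coords (h k')) k = (if k' = k then lookup ?v k else 0)"
        by (auto simp: lookup_minus lookup_single when_def)
    qed
    also have "\<dots> = (if k \<in> T then lookup ?v k else 0)"
      using \<open>finite T\<close> by simp
    also have "\<dots> = lookup ?v k"
    proof (cases "total_degree k = d")
      case False
      with k have "Suc d \<le> total_degree k" by simp
      then have "lookup ?v k = 0" using Suc.prems(2) unfolding low_def by blast
      then show ?thesis by simp
    qed (auto simp: T_def in_keys_iff)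
    finally show "lookup (coords (f - t)) k = 0"
      by (simp add: lin_diff [OF lin_coords] lookup_minus)
  qed
  then have "cl (f - t) \<in> B"
    using Suc.prems(1) \<open>central t\<close> by (intro Suc.IH central_diff)
  then show ?case using B_add [of "f - t" t] \<open>cl t \<in> B\<close> by simp
qed

lemma center_eq_B: "ring_center A = B"
proof
  show "ring_center A \<subseteq> B"
  proof
    fix x assume "x \<in> ring_center A"
    then obtain f where f: "x = cl f" "central f" by (auto simp: center_A)
    \<comment> \<open>Finite support of \<open>coords f\<close> provides a starting bound for the
      induction.\<close>
    obtain d where "\<And>k. k \<in> keys (coords f) \<Longrightarrow> total_degree k < d"
      using finite_nat_set_iff_bounded [of "total_degree ` keys (coords f)"] by auto
    then have "low d (coords f)"
      by (metis in_keys_iff low_def not_le)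
    with f show "x \<in> B" using central_in_B by simp
  qed
qed (rule B_subset_center)

end

theorem theorem2p5:
  fixes q \<alpha> \<beta> \<gamma> :: "'k :: alg_closed_field" and l :: nat
  assumes "q \<noteq> 0"
    and "l > 1"
    and "primitive_root_of_unity l (q^2)"
  defines "A \<equiv> weyl_algebra q \<alpha> \<beta> \<gamma>"
  shows "ring_center A =
    weyl_subalgebra_generated q \<alpha> \<beta> \<gamma>
      {weyl_gen q \<alpha> \<beta> \<gamma> GX [^]\<^bsub>A\<^esub> l,
       weyl_gen q \<alpha> \<beta> \<gamma> GY [^]\<^bsub>A\<^esub> l,
       weyl_gen q \<alpha> \<beta> \<gamma> GZ [^]\<^bsub>A\<^esub> l,
       weyl_Omega q \<alpha> \<beta> \<gamma>}"
proof -
  interpret W: weyl_root q \<alpha> \<beta> \<gamma> l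
    by unfold_locales (use assms in auto)
  show ?thesis
    unfolding A_def weyl_gen_def W.cl_power W.cl_Om by (rule W.center_eq_B)
qed

end
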